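(* Let $X$ be a real Archimedean vector lattice and let $X^u$ be its universal completion, with $X$ regarded as a sublattice of $X^u$. Then the following seven conditions are equivalent: (1) $\dim(X)<\infty$; (2) every $uo$-Cauchy net in $X$ is eventually order bounded in $X^u$; (3) every $uo$-Cauchy net in $X$ is $o$-convergent in $X^u$ (i.e. $o$-converges in $X^u$ to some element of $X^u$); (4) every $uo$-null net in $X$ is $o$-null in $X^u$; (5) every $uo$-null net in $X$ is eventually order bounded in $X^u$; (6) every $uo$-convergent net in $X$ is eventually order bounded in $X^u$; (7) every $uo$-convergent net in $X$ is eventually order bounded in $X$.
   Context: All vector lattices are real and Archimedean. Nets are indexed by arbitrary (nonempty) directed sets. Universal completion: a vector lattice is Dedekind complete if every nonempty order bounded subset has a supremum (and an infimum). A Dedekind complete vector lattice $Z$ is universally complete if every pairwise disjoint subset of $Z_+$ has a supremum in $Z$. A sublattice $Y$ of a vector lattice $Z$ is order dense if for every $0\neq z\in Z_+$ there is $0\neq y\in Y_+$ with $y\le z$. The universal completion $X^u$ of $X$ is the (unique up to lattice isomorphism) universally complete vector lattice containing $X$ as an order dense sublattice. Order convergence: a net $(x_\alpha)_{\alpha\in A}$ in a vector lattice $Z$ $o$-converges to $x\in Z$ (in $Z$) if there is a net $(y_\gamma)_{\gamma\in\Gamma}$ in $Z$ (possibly over a different index set) with $y_\gamma\downarrow 0$ (i.e. decreasing with infimum $0$ in $Z$) such that for every $\gamma\in\Gamma$ there is $\alpha_\gamma\in A$ with $|x_\alpha-x|\le y_\gamma$ for all $\alpha\ge\alpha_\gamma$.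 The net is $o$-null if it $o$-converges to $0$. Unbounded order convergence: a net $(x_\alpha)$ in $Z$ $uo$-converges to $x\in Z$ (in $Z$) if $|x_\alpha-x|\wedge y$ $o$-converges to $0$ in $Z$ for every $y\in Z_+$. It is $uo$-null if it $uo$-converges to $0$. In the conditions above, "$uo$-null net in $X$", "$uo$-convergent net in $X$" and "$uo$-Cauchy net in $X$" are understood with $Z=X$. $uo$-Cauchy: a net $(x_\alpha)_{\alpha\in A}$ in $Z$ is $uo$-Cauchy if the double net $(x_\alpha-x_\beta)_{(\alpha,\beta)\in A\times A}$, indexed by $A\times A$ with the coordinatewise order, $uo$-converges to $0$. Eventually order bounded: a net $(x_\alpha)_{\alpha\in A}$ is eventually order bounded in $Z$ if there are $\alpha_0\in A$ and $y\in Z_+$ with $|x_\alpha|\le y$ for all $\alpha\ge\alpha_0$. *)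

theory Defs
  imports Complex_Main "HOL-Library.Lattice_Algebras" "HOL-Library.Lub_Glb"
begin

text \<open>
  Real Archimedean vector lattices. The class \<^class>\<open>lattice_ab_group_add_abs\<close> forces
  the modulus to be \<open>\<bar>x\<bar> = sup x (- x)\<close>.
\<close>

class archimedean_vector_lattice = ordered_real_vector + lattice_ab_group_add_abs +
  assumes archimedean:
    "0 \<le> x \<Longrightarrow> 0 \<le> y \<Longrightarrow> (\<And>n::nat. real n *\<^sub>R x \<le> y) \<Longrightarrow> x = 0"


section \<open>Universal completion\<close>

definition dedekind_complete :: "'b::archimedean_vector_lattice itself \<Rightarrow> bool" where
  "dedekind_complete _ \<longleftrightarrow>
     (\<forall>S::'b set. S \<noteq> {} \<and> (\<exists>a b. S \<subseteq> {a..b}) \<longrightarrow>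
        (\<exists>s. isLub UNIV S s) \<and> (\<exists>i. isGlb UNIV S i))"

text \<open>
  The empty set is excluded below: its supremum in the whole space would be a least element,
  which exists only in the zero space.
\<close>

definition universally_complete :: "'b::archimedean_vector_lattice itself \<Rightarrow> bool" where
  "universally_complete _ \<longleftrightarrow>
     dedekind_complete TYPE('b) \<and>
     (\<forall>S::'b set. S \<noteq> {} \<and> (\<forall>x\<in>S. 0 \<le> x) \<and> pairwise (\<lambda>x y. inf x y = 0) S \<longrightarrow>
        (\<exists>s. isLub UNIV S s))"

definition order_dense :: "'b::archimedean_vector_lattice set \<Rightarrow> bool" where
  "order_dense Y \<longleftrightarrow> (\<forall>z. 0 \<le> z \<and> z \<noteq> 0 \<longrightarrow> (\<exists>y\<in>Y. 0 \<le> y \<and> y \<noteq> 0 \<and> y \<le> z))"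

text \<open>
  \<open>T\<close> is the inclusion of a vector lattice, as an order dense sublattice, into its universal
  completion \<open>'b\<close>.
\<close>

definition universal_completion ::
    "('a::archimedean_vector_lattice \<Rightarrow> 'b::archimedean_vector_lattice) \<Rightarrow> bool" where
  "universal_completion T \<longleftrightarrow>
     universally_complete TYPE('b) \<and>
     linear T \<and> inj T \<and>
     (\<forall>x y. T (sup x y) = sup (T x) (T y)) \<and>
     (\<forall>x y. T (inf x y) = inf (T x) (T y)) \<and>
     order_dense (range T)"


section \<open>Nets and their convergence\<close>

text \<open>
  A directed set is a nonempty set \<open>D\<close>, preordered by \<open>le\<close> on \<open>D\<close>, in which any two elements
  have an upper bound; antisymmetry is not required. A net over it is a function of which only
  the values on \<open>D\<close> matter.

  HOL cannot quantify over types inside a formula, so "every net" has to mean "every net whose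
  index set is a subset of \<open>'i\<close>", with \<open>'i\<close> a type variable of the theorem. Since \<open>'i\<close> is
  arbitrary, all directed sets are covered. Finite \<open>'i\<close> must be excluded there, because a
  finite directed set has a largest element and nets over it are trivially bounded.
\<close>

definition directed_set :: "'i set \<Rightarrow> ('i \<Rightarrow> 'i \<Rightarrow> bool) \<Rightarrow> bool" where
  "directed_set D le \<longleftrightarrow>
     D \<noteq> {} \<and> reflp_on D le \<and> transp_on D le \<and> (\<forall>a\<in>D. \<forall>b\<in>D. \<exists>c\<in>D. le a c \<and> le b c)"

definition decreases_to_zero ::
    "'g set \<Rightarrow> ('g \<Rightarrow> 'g \<Rightarrow> bool) \<Rightarrow> ('g \<Rightarrow> 'b::archimedean_vector_lattice) \<Rightarrow> bool" where
  "decreases_to_zero G leG y \<longleftrightarrow> monotone_on G leG (\<ge>) y \<and> isGlb UNIV (y ` G) 0"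

text \<open>
  The index set of the dominating net has to live in some fixed type; the type \<open>'b\<close> of the
  values is large enough, as \<open>o_convI\<close> below shows.
\<close>

definition o_conv ::
    "'i set \<Rightarrow> ('i \<Rightarrow> 'i \<Rightarrow> bool) \<Rightarrow> ('i \<Rightarrow> 'b::archimedean_vector_lattice) \<Rightarrow> 'b \<Rightarrow> bool" where
  "o_conv D le x l \<longleftrightarrow>
     (\<exists>(G::'b set) leG y. directed_set G leG \<and> decreases_to_zero G leG y \<and>
        (\<forall>g\<in>G. \<exists>a0\<in>D. \<forall>a\<in>D. le a0 a \<longrightarrow> \<bar>x a - l\<bar> \<le> y g))"

lemma o_convI:
  fixes G :: "'g set" and x :: "'i \<Rightarrow> 'b::archimedean_vector_lattice"
  assumes dir: "directed_set G leG" and dec: "decreases_to_zero G leG y"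
    and dom: "\<forall>g\<in>G. \<exists>a0\<in>D. \<forall>a\<in>D. le a0 a \<longrightarrow> \<bar>x a - l\<bar> \<le> y g"
  shows "o_conv D le x l"
proof -
  have "directed_set (y ` G) (\<ge>)"
    unfolding directed_set_def
  proof (intro conjI)
    show "y ` G \<noteq> {}"
      using dir by (simp add: directed_set_def)
    show "reflp_on (y ` G) (\<ge>)"
      by (simp add: reflp_on_def)
    show "transp_on (y ` G) (\<ge>)"
      by (auto simp: transp_on_def)
    show "\<forall>u\<in>y ` G. \<forall>v\<in>y ` G. \<exists>w\<in>y ` G. u \<ge> w \<and> v \<ge> w"
    proof clarify
      fix a b
      assume ab: "a \<in> G" "b \<in> G"
      then obtain c where "c \<in> G" "leG a c" "leG b c"
        using dir unfolding directed_set_def by blast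
      then show "\<exists>w\<in>y ` G. y a \<ge> w \<and> y b \<ge> w"
        using ab dec unfolding decreases_to_zero_def monotone_on_def by blast
    qed
  qed
  moreover have "decreases_to_zero (y ` G) (\<ge>) (\<lambda>z. z)"
    using dec by (simp add: decreases_to_zero_def monotone_on_def)
  ultimately show ?thesis
    using dom unfolding o_conv_def by (intro exI[of _ "y ` G"] exI[of _ "(\<ge>)"] exI[of _ "\<lambda>z. z"]) auto
qed

definition uo_conv ::
    "'i set \<Rightarrow> ('i \<Rightarrow> 'i \<Rightarrow> bool) \<Rightarrow> ('i \<Rightarrow> 'b::archimedean_vector_lattice) \<Rightarrow> 'b \<Rightarrow> bool" where
  "uo_conv D le x l \<longleftrightarrow> (\<forall>y\<ge>0. o_conv D le (\<lambda>a. inf \<bar>x a - l\<bar> y) 0)"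

definition uo_cauchy ::
    "'i set \<Rightarrow> ('i \<Rightarrow> 'i \<Rightarrow> bool) \<Rightarrow> ('i \<Rightarrow> 'b::archimedean_vector_lattice) \<Rightarrow> bool" where
  "uo_cauchy D le x \<longleftrightarrow> uo_conv (D \<times> D) (rel_prod le le) (\<lambda>(a, b). x a - x b) 0"

definition eventually_order_bounded ::
    "'i set \<Rightarrow> ('i \<Rightarrow> 'i \<Rightarrow> bool) \<Rightarrow> ('i \<Rightarrow> 'b::archimedean_vector_lattice) \<Rightarrow> bool" where
  "eventually_order_bounded D le x \<longleftrightarrow>
     (\<exists>a0\<in>D. \<exists>y\<ge>0. \<forall>a\<in>D. le a0 a \<longrightarrow> \<bar>x a\<bar> \<le> y)"

end

theory Submission
  imports Defs "HOL-Library.Nat_Bijection"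
begin

text \<open>
  What decides everything is whether \<open>X\<close> contains an infinite set of nonzero pairwise disjoint
  positive elements.

  If it does, take a disjoint sequence \<open>e\<^sub>0, e\<^sub>1, \<dots>\<close> in it and consider all multiples \<open>m e\<^sub>n\<close>,
  indexed by the pairs \<open>(n, m)\<close> and preordered by \<open>n\<close> alone. Disjointness makes this net
  \<open>uo\<close>-null, whatever the factors \<open>m\<close> are (\<open>disjoint_multiples_uo_null\<close>). But every tail
  contains all multiples of a single \<open>e\<^sub>n\<close>, so no Archimedean vector lattice into which \<open>X\<close>
  embeds, \<open>X\<^sup>u\<close> in particular, contains a bound for a tail (\<open>disjoint_multiples_unbounded\<close>).
  An ordinary disjoint sequence would not do: it does have a supremum in \<open>X\<^sup>u\<close>. Each of the
  conditions on nets would make this one eventually order bounded in \<open>X\<^sup>u\<close>, because a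
  \<open>uo\<close>-null net is \<open>uo\<close>-Cauchy and an \<open>o\<close>-convergent net is eventually order bounded.

  If it does not, repeated splitting shows that every nonzero positive element dominates an atom, and
  a maximal disjoint set \<open>A\<close> of atoms is a finite basis of \<open>X\<close> in which positive elements have
  positive coordinates (\<open>complete_atoms_expansion\<close>). Conversely, disjoint nonzero elements are
  linearly independent, so this case is exactly \<open>dim X < \<infinity>\<close>
  (\<open>finite_dimensional_iff_finite_disjoint\<close>). In the lattice spanned by \<open>A\<close>, a \<open>uo\<close>-null net is
  null uniformly with respect to the strong unit \<open>e = \<Sum>A\<close> (\<open>uo_null_uniformly_null\<close>): only
  finitely many coordinates have to become small. From uniform convergence with respect to \<open>e\<close>
  everything follows: a null net is \<open>o\<close>-null in \<open>X\<^sup>u\<close>, where it is dominated by the multiples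
  \<open>\<epsilon> e\<close>, and a Cauchy net has a limit in \<open>X\<^sup>u\<close> by Dedekind completeness.
\<close>

section \<open>Archimedean vector lattices\<close>

text \<open>
  The Archimedean property for a possibly negative or sign-changing \<open>w\<close> and real factors: it is
  applied to the positive part of \<open>w\<close>.
\<close>
lemma archimedean_le_zero:
  fixes w y :: "'a::archimedean_vector_lattice"
  assumes "0 \<le> y" and small: "\<And>\<epsilon>. 0 < \<epsilon> \<Longrightarrow> w \<le> \<epsilon> *\<^sub>R y"
  shows "w \<le> 0"
proof -
  have "sup w 0 = 0"
  proof (rule archimedean[OF _ \<open>0 \<le> y\<close>])
    fix n :: nat
    show "real n *\<^sub>R sup w 0 \<le> y"
    proof (cases "n = 0")
      case False
      then have "sup w 0 \<le> (1 / real n) *\<^sub>R y"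
        using small[of "1 / real n"] \<open>0 \<le> y\<close> by (simp add: scaleR_nonneg_nonneg)
      from scaleR_left_mono[OF this, of "real n"] show ?thesis
        using False by simp
    qed (use \<open>0 \<le> y\<close> in simp)
  qed simp
  then show ?thesis
    by (metis sup.cobounded1)
qed

lemma scaleR_inf:
  fixes x y :: "'a::archimedean_vector_lattice"
  assumes "0 < c"
  shows "c *\<^sub>R inf x y = inf (c *\<^sub>R x) (c *\<^sub>R y)"
proof (rule antisym)
  show "c *\<^sub>R inf x y \<le> inf (c *\<^sub>R x) (c *\<^sub>R y)"
    using assms by (simp add: scaleR_left_mono)
  have "inverse c *\<^sub>R inf (c *\<^sub>R x) (c *\<^sub>R y) \<le> inf x y"
    using assms scaleR_left_mono[of "inf (c *\<^sub>R x) (c *\<^sub>R y)" "c *\<^sub>R x" "inverse c"]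
      scaleR_left_mono[of "inf (c *\<^sub>R x) (c *\<^sub>R y)" "c *\<^sub>R y" "inverse c"] by simp
  from scaleR_left_mono[OF this, of c] show "inf (c *\<^sub>R x) (c *\<^sub>R y) \<le> c *\<^sub>R inf x y"
    using assms by simp
qed

lemma abs_scaleR_lattice:
  fixes x :: "'a::archimedean_vector_lattice"
  shows "\<bar>c *\<^sub>R x\<bar> = \<bar>c\<bar> *\<^sub>R \<bar>x\<bar>"
proof -
  have pos: "\<bar>c *\<^sub>R x\<bar> = c *\<^sub>R \<bar>x\<bar>" if "0 < c" for c :: real and x :: 'a
  proof -
    have "\<bar>c *\<^sub>R x\<bar> = - inf (- (c *\<^sub>R x)) (c *\<^sub>R x)"
      by (simp add: abs_lattice neg_inf_eq_sup)
    also have "\<dots> = - (c *\<^sub>R inf (- x) x)"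
      using that by (simp add: scaleR_inf)
    also have "\<dots> = c *\<^sub>R \<bar>x\<bar>"
      by (simp add: abs_lattice neg_inf_eq_sup flip: scaleR_minus_right)
    finally show ?thesis .
  qed
  consider "c = 0" | "0 < c" | "0 < - c" by linarith
  then show ?thesis
  proof cases
    case 3
    then show ?thesis using pos[of "- c" x] by simp
  qed (simp_all add: pos)
qed

text \<open>
  Expanding \<open>inf x y + inf x z\<close> gives the infimum of \<open>x + x\<close>, \<open>y + x\<close>, \<open>x + z\<close> and \<open>y + z\<close>, and the
  first three of these dominate \<open>x\<close>.
\<close>
lemma inf_add_le:
  fixes x y z :: "'a::archimedean_vector_lattice"
  assumes "0 \<le> x" "0 \<le> y" "0 \<le> z"
  shows "inf x (y + z) \<le> inf x y + inf x z"
proof -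
  have "inf x y + inf x z = inf (inf (x + x) (y + x)) (inf (x + z) (y + z))"
    by (simp add: add_inf_distrib_left add_inf_distrib_right)
  moreover have "x \<le> x + x" "x \<le> y + x" "x \<le> x + z"
    using assms by simp_all
  ultimately show ?thesis
    by (simp add: le_infI1)
qed

lemma disjoint_mono:
  fixes x y :: "'a::archimedean_vector_lattice"
  assumes "inf x y = 0" "0 \<le> x'" "x' \<le> x" "0 \<le> y'" "y' \<le> y"
  shows "inf x' y' = 0"
  using inf_mono[OF assms(3,5)] assms by (simp add: order_antisym)

text \<open>
  Scaling both elements by the same factor \<open>max 1 c\<close> keeps them disjoint, and this enlarges \<open>x\<close>
  and dominates \<open>c *\<^sub>R y\<close>.
\<close>
lemma disjoint_scaleR:
  fixes x y :: "'a::archimedean_vector_lattice"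
  assumes "inf x y = 0" "0 \<le> c"
  shows "inf x (c *\<^sub>R y) = 0"
proof (rule disjoint_mono)
  have nonneg: "0 \<le> x" "0 \<le> y"
    using assms(1) by (metis inf.cobounded1, metis inf.cobounded2)
  show "inf (max 1 c *\<^sub>R x) (max 1 c *\<^sub>R y) = 0"
    using assms(1) scaleR_inf[of "max 1 c" x y] by simp
  show "0 \<le> x" by (fact nonneg)
  show "x \<le> max 1 c *\<^sub>R x"
    using scaleR_right_mono[of 1 "max 1 c" x] nonneg by simp
  show "0 \<le> c *\<^sub>R y"
    using nonneg assms(2) by (simp add: scaleR_nonneg_nonneg)
  show "c *\<^sub>R y \<le> max 1 c *\<^sub>R y"
    using nonneg by (simp add: scaleR_right_mono)
qed

text \<open>
  The sum of disjoint elements is their supremum.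
\<close>
lemma disjoint_add_le:
  fixes x y z :: "'a::archimedean_vector_lattice"
  assumes "inf x y = 0" "x \<le> z" "y \<le> z"
  shows "x + y \<le> z"
  using assms add_eq_inf_sup[of x y] by simp

lemma subspace_disjoint_complement:
  fixes b :: "'a::archimedean_vector_lattice"
  assumes "0 \<le> b"
  shows "subspace {x. inf b \<bar>x\<bar> = 0}"
proof (rule subspaceI, safe)
  show "inf b \<bar>0\<bar> = 0"
    using assms by (simp add: inf_absorb2)
  fix x y assume "inf b \<bar>x\<bar> = 0" "inf b \<bar>y\<bar> = 0"
  then have "inf b (\<bar>x\<bar> + \<bar>y\<bar>) = 0"
    using inf_add_le[OF assms, of "\<bar>x\<bar>" "\<bar>y\<bar>"] assms by (simp add: order_antisym)
  then show "inf b \<bar>x + y\<bar> = 0"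
    by (rule disjoint_mono) (use assms abs_triangle_ineq in auto)
next
  fix x and c :: real assume "inf b \<bar>x\<bar> = 0"
  then show "inf b \<bar>c *\<^sub>R x\<bar> = 0"
    by (simp add: abs_scaleR_lattice disjoint_scaleR)
qed

definition disjoint_positive :: "'a::archimedean_vector_lattice set \<Rightarrow> bool" where
  "disjoint_positive S \<longleftrightarrow> (\<forall>x\<in>S. 0 < x) \<and> pairwise (\<lambda>x y. inf x y = 0) S"

text \<open>
  The disjoint complement of an element \<open>b\<close> of \<open>S\<close> is a subspace containing the rest of \<open>S\<close>,
  hence the span of the rest, but it does not contain \<open>b\<close> itself.
\<close>
lemma disjoint_positive_independent:
  fixes S :: "'a::archimedean_vector_lattice set"
  assumes "disjoint_positive S"
  shows "independent S"
  unfolding dependent_def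
proof
  assume "\<exists>b\<in>S. b \<in> span (S - {b})"
  then obtain b where b: "b \<in> S" "b \<in> span (S - {b})" by blast
  then have "0 < b" using assms by (simp add: disjoint_positive_def)
  have "span (S - {b}) \<subseteq> {x. inf b \<bar>x\<bar> = 0}"
  proof (rule span_minimal)
    show "S - {b} \<subseteq> {x. inf b \<bar>x\<bar> = 0}"
      using assms b(1) unfolding disjoint_positive_def pairwise_def
      by (auto simp: abs_of_nonneg less_imp_le)
    show "subspace {x. inf b \<bar>x\<bar> = 0}"
      using \<open>0 < b\<close> by (simp add: subspace_disjoint_complement)
  qed
  then show False
    using b(2) \<open>0 < b\<close> by auto
qed

section \<open>Atoms\<close>

definition atom :: "'a::archimedean_vector_lattice \<Rightarrow> bool" where
  "atom a \<longleftrightarrow> 0 < a \<and>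
     (\<forall>u v. 0 \<le> u \<and> u \<le> a \<and> 0 \<le> v \<and> v \<le> a \<and> inf u v = 0 \<longrightarrow> u = 0 \<or> v = 0)"

lemma pos_neg_parts_disjoint:
  fixes x :: "'a::archimedean_vector_lattice"
  shows "inf (sup x 0) (sup (- x) 0) = 0"
proof -
  have "sup (- x) 0 = sup x 0 + - x"
    using add_sup_distrib_right[of x 0 "- x"] by (simp add: sup.commute)
  then have "inf (sup x 0) (sup (- x) 0) = sup x 0 + inf 0 (- x)"
    using add_inf_distrib_left[of "sup x 0" 0 "- x"] by simp
  also have "inf 0 (- x) = - sup x 0"
    using inf_eq_neg_sup[of 0 "- x"] by (simp add: inf.commute)
  finally show ?thesis by (simp only: right_minus)
qed

text \<open>
  Up to scale, nothing lies strictly between \<open>0\<close> and an atom: the positive and negative parts of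
  \<open>p - r *\<^sub>R a\<close> are disjoint and, for \<open>r \<le> 1\<close>, both are below \<open>a\<close>, so that \<open>p\<close> is comparable with
  \<open>r *\<^sub>R a\<close>. If \<open>p\<close> were below all these multiples, it would vanish.
\<close>
lemma atom_scaleR_le:
  fixes a p :: "'a::archimedean_vector_lattice"
  assumes "atom a" "0 < p" "p \<le> a"
  shows "\<exists>r>0. r *\<^sub>R a \<le> p"
proof (rule ccontr)
  assume no: "\<not> (\<exists>r>0. r *\<^sub>R a \<le> p)"
  have "0 < a" using assms(1) by (simp add: atom_def)
  have le: "p \<le> r *\<^sub>R a" if "0 < r" "r \<le> 1" for r
  proof -
    have ra: "0 \<le> r *\<^sub>R a" "r *\<^sub>R a \<le> a"
      using that \<open>0 < a\<close> scaleR_right_mono[of r 1 a] by (simp_all add: scaleR_nonneg_nonneg less_imp_le)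
    have "p - r *\<^sub>R a \<le> a" "r *\<^sub>R a - p \<le> a"
      using ra assms by (simp_all add: diff_le_eq add_increasing2 less_imp_le)
    then have "sup (p - r *\<^sub>R a) 0 = 0 \<or> sup (- (p - r *\<^sub>R a)) 0 = 0"
      using assms(1) pos_neg_parts_disjoint[of "p - r *\<^sub>R a"] \<open>0 < a\<close> unfolding atom_def by simp
    then have "p - r *\<^sub>R a \<le> 0 \<or> - (p - r *\<^sub>R a) \<le> 0"
      by (metis sup.cobounded1)
    moreover have "\<not> - (p - r *\<^sub>R a) \<le> 0"
      using no that by simp
    ultimately show ?thesis by simp
  qed
  have "p \<le> 0"
  proof (rule archimedean_le_zero)
    show "0 \<le> a" using \<open>0 < a\<close> by simp
    fix \<epsilon> :: real assume "0 < \<epsilon>"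
    then have "p \<le> min \<epsilon> 1 *\<^sub>R a" by (intro le) auto
    also have "\<dots> \<le> \<epsilon> *\<^sub>R a" using \<open>0 < a\<close> by (simp add: scaleR_right_mono)
    finally show "p \<le> \<epsilon> *\<^sub>R a" .
  qed
  then show False using assms(2) by simp
qed

text \<open>
  The coordinate \<open>t\<close> of \<open>x\<close> at the atom \<open>a\<close> is the largest \<open>s\<close> with \<open>s *\<^sub>R a \<le> x\<close>. It exists by
  the Archimedean property; a remainder that still met \<open>a\<close> would dominate a further multiple of
  \<open>a\<close>, contradicting maximality.
\<close>
lemma atom_component:
  fixes a x :: "'a::archimedean_vector_lattice"
  assumes "atom a" "0 \<le> x"
  shows "\<exists>t\<ge>0. t *\<^sub>R a \<le> x \<and> inf (x - t *\<^sub>R a) a = 0"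
proof -
  have "0 < a" using assms(1) by (simp add: atom_def)
  define S where "S = {s. s *\<^sub>R a \<le> x}"
  have "\<exists>n::nat. \<not> real n *\<^sub>R a \<le> x"
    using archimedean[of a x] assms(2) \<open>0 < a\<close> by (auto simp: less_imp_le)
  then obtain n :: nat where n: "\<not> real n *\<^sub>R a \<le> x" by blast
  have "s \<le> real n" if "s \<in> S" for s
  proof (rule ccontr)
    assume "\<not> s \<le> real n"
    then have "real n *\<^sub>R a \<le> s *\<^sub>R a" using \<open>0 < a\<close> by (simp add: scaleR_right_mono)
    also have "\<dots> \<le> x" using that by (simp add: S_def)
    finally show False using n by simp
  qed
  then have bdd: "bdd_above S" by (rule bdd_aboveI)
  have "0 \<in> S" using assms(2) by (simp add: S_def)
  define t where "t = Sup S"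
  have "t \<ge> 0" unfolding t_def by (rule cSup_upper[OF \<open>0 \<in> S\<close> bdd])
  have "t *\<^sub>R a - x \<le> 0"
  proof (rule archimedean_le_zero)
    show "0 \<le> a" using \<open>0 < a\<close> by simp
    fix \<epsilon> :: real assume "0 < \<epsilon>"
    then obtain s where s: "s \<in> S" "t - \<epsilon> < s"
      using less_cSup_iff[of S "t - \<epsilon>"] bdd \<open>0 \<in> S\<close> unfolding t_def by auto
    then have "(t - \<epsilon>) *\<^sub>R a \<le> s *\<^sub>R a" using \<open>0 < a\<close> by (simp add: scaleR_right_mono)
    also have "\<dots> \<le> x" using s(1) by (simp add: S_def)
    finally show "t *\<^sub>R a - x \<le> \<epsilon> *\<^sub>R a" by (simp add: algebra_simps)
  qed
  then have tx: "t *\<^sub>R a \<le> x" by simp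
  moreover have "inf (x - t *\<^sub>R a) a = 0"
  proof (rule ccontr)
    assume "inf (x - t *\<^sub>R a) a \<noteq> 0"
    then have "0 < inf (x - t *\<^sub>R a) a"
      using tx \<open>0 < a\<close> by (metis diff_ge_0_iff_ge le_infI less_imp_le order_le_less)
    then obtain r where r: "r > 0" "r *\<^sub>R a \<le> inf (x - t *\<^sub>R a) a"
      using atom_scaleR_le[OF assms(1)] inf.cobounded2 by blast
    then have "t + r \<in> S" by (simp add: S_def algebra_simps)
    then have "t + r \<le> t" unfolding t_def using bdd by (rule cSup_upper)
    then show False using r by simp
  qed
  ultimately show ?thesis using \<open>t \<ge> 0\<close> by blast
qed

text \<open>
  The atoms are split off one at a time. The remainder only decreases on the way, so it stays
  disjoint from the atoms that were treated before.
\<close>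
lemma atoms_decomposition:
  fixes x :: "'a::archimedean_vector_lattice"
  assumes "finite A" "\<forall>a\<in>A. atom a" "0 \<le> x"
  shows "\<exists>t. (\<forall>a\<in>A. 0 \<le> t a \<and> t a *\<^sub>R a \<le> x) \<and> (\<Sum>a\<in>A. t a *\<^sub>R a) \<le> x \<and>
           (\<forall>a\<in>A. inf (x - (\<Sum>a\<in>A. t a *\<^sub>R a)) a = 0)"
  using assms(1,2)
proof (induction A)
  case empty
  then show ?case using assms(3) by simp
next
  case (insert b A)
  then obtain t where t: "\<forall>a\<in>A. 0 \<le> t a \<and> t a *\<^sub>R a \<le> x" "(\<Sum>a\<in>A. t a *\<^sub>R a) \<le> x"
    "\<forall>a\<in>A. inf (x - (\<Sum>a\<in>A. t a *\<^sub>R a)) a = 0" by auto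
  define s where "s = (\<Sum>a\<in>A. t a *\<^sub>R a)"
  have pos: "0 \<le> a" if "a \<in> insert b A" for a
    using insert.prems that by (auto simp: atom_def)
  have "0 \<le> s" unfolding s_def using t(1) pos by (intro sum_nonneg) (simp add: scaleR_nonneg_nonneg)
  obtain r where r: "0 \<le> r" "r *\<^sub>R b \<le> x - s" "inf (x - s - r *\<^sub>R b) b = 0"
    using atom_component[of b "x - s"] insert.prems t(2) by (auto simp: s_def)
  let ?t = "t(b := r)"
  have sum: "(\<Sum>a\<in>insert b A. ?t a *\<^sub>R a) = r *\<^sub>R b + s"
    unfolding s_def using insert.hyps by (auto intro!: sum.cong)
  have le: "r *\<^sub>R b \<le> x"
    using r(2) \<open>0 \<le> s\<close> by (metis diff_le_eq add_increasing2 order_trans order_refl le_add_same_cancel1)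
  have "inf (x - (r *\<^sub>R b + s)) a = 0" if "a \<in> A" for a
  proof (rule disjoint_mono)
    show "inf (x - s) a = 0" using t(3) that by (simp add: s_def)
    show "0 \<le> x - (r *\<^sub>R b + s)" using r(2) by (simp add: algebra_simps)
    show "x - (r *\<^sub>R b + s) \<le> x - s"
      using r(1) pos by (simp add: scaleR_nonneg_nonneg)
    show "0 \<le> a" using pos that by simp
  qed simp
  moreover have "inf (x - (r *\<^sub>R b + s)) b = 0"
    using r(3) by (simp add: diff_diff_eq add.commute)
  moreover have "r *\<^sub>R b + s \<le> x"
    using r(2) by (simp add: le_diff_eq)
  ultimately have "\<forall>a\<in>insert b A. inf (x - (r *\<^sub>R b + s)) a = 0" by blast
  moreover have "\<forall>a\<in>insert b A. 0 \<le> ?t a \<and> ?t a *\<^sub>R a \<le> x"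
    using t(1) r(1) le by simp
  ultimately show ?case
    using \<open>r *\<^sub>R b + s \<le> x\<close> by (intro exI[of _ ?t]) (simp only: sum simp_thms)
qed

text \<open>
  If no atom lies below \<open>y\<close>, then every positive \<open>z \<le> y\<close> dominates two disjoint nonzero parts.
  Setting one part aside and splitting the other one again, without end, produces an infinite
  disjoint set.
\<close>
lemma atom_below_of_finite_disjoint:
  fixes y :: "'a::archimedean_vector_lattice"
  assumes fin: "\<And>S::'a set. disjoint_positive S \<Longrightarrow> finite S" and "0 < y"
  shows "\<exists>a\<le>y. atom a"
proof (rule ccontr)
  assume none: "\<not> (\<exists>a\<le>y. atom a)"
  have split: "\<exists>u v. 0 < u \<and> u \<le> z \<and> 0 < v \<and> v \<le> z \<and> inf u v = 0" if "0 < z" "z \<le> y" for z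
  proof -
    have "\<not> atom z" using none that(2) by blast
    then show ?thesis using that(1) unfolding atom_def by (auto simp: order_le_less)
  qed
  \<comment> \<open>a pair \<open>(u, v)\<close> holds the part \<open>u\<close> set aside and the part \<open>v\<close> to be split next\<close>
  define P :: "nat \<Rightarrow> 'a \<times> 'a \<Rightarrow> bool"
    where "P = (\<lambda>_ (u, v). 0 < u \<and> 0 < v \<and> v \<le> y \<and> inf u v = 0)"
  define Q :: "nat \<Rightarrow> 'a \<times> 'a \<Rightarrow> 'a \<times> 'a \<Rightarrow> bool"
    where "Q = (\<lambda>_ (u, v) (u', v'). u' \<le> v \<and> v' \<le> v)"
  have "\<exists>f. \<forall>n. P n (f n) \<and> Q n (f n) (f (Suc n))"
  proof (rule dependent_nat_choice)
    show "\<exists>p. P 0 p"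
      using split[OF \<open>0 < y\<close> order_refl] by (auto simp: P_def)
    fix p n assume "P n p"
    obtain u v where p: "p = (u, v)" by (cases p)
    obtain u' v' where "0 < u'" "u' \<le> v" "0 < v'" "v' \<le> v" "inf u' v' = 0"
      using split[of v] \<open>P n p\<close> by (auto simp: P_def p)
    then have "P (Suc n) (u', v') \<and> Q n p (u', v')"
      using \<open>P n p\<close> by (auto simp: P_def Q_def p)
    then show "\<exists>q. P (Suc n) q \<and> Q n p q" by blast
  qed
  then obtain f where f: "\<And>n. P n (f n)" "\<And>n. Q n (f n) (f (Suc n))" by blast
  define u v where "u n = fst (f n)" and "v n = snd (f n)" for n
  have uv: "0 < u n" "0 < v n" "inf (u n) (v n) = 0" "u (Suc n) \<le> v n" "v (Suc n) \<le> v n" for n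
    using f[of n] by (auto simp: P_def Q_def u_def v_def split: prod.splits)
  have dec: "v n \<le> v m" if "m \<le> n" for m n
    using lift_Suc_antimono_le[of v] uv(5) that by blast
  have disj: "inf (u m) (u n) = 0" if "m < n" for m n
  proof (rule disjoint_mono[OF uv(3)[of m]])
    show "u n \<le> v m" using order_trans[OF uv(4)[of "n - 1"] dec[of m "n - 1"]] \<open>m < n\<close> by simp
  qed (use uv(1) less_imp_le in auto)
  have sep: "inf (u m) (u n) = 0" if "m \<noteq> n" for m n
    using disj[of m n] disj[of n m] that by (metis inf.commute nat_neq_iff)
  have "inj u"
  proof (rule injI)
    fix m n assume "u m = u n"
    then show "m = n" using sep[of m n] uv(1)[of n] by force
  qed
  moreover have "disjoint_positive (range u)"
    unfolding disjoint_positive_def pairwise_def using uv(1) sep by (metis rangeE)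
  ultimately show False
    using fin finite_imageD[of u UNIV] by blast
qed

text \<open>
  The last condition says that the band generated by \<open>A\<close> is the whole space: it leaves no
  remainder when the atoms are split off an element one after the other.
\<close>
definition complete_atoms :: "'a::archimedean_vector_lattice set \<Rightarrow> bool" where
  "complete_atoms A \<longleftrightarrow> finite A \<and> (\<forall>a\<in>A. atom a) \<and>
     (\<forall>x\<ge>0. (\<forall>a\<in>A. inf x a = 0) \<longrightarrow> x = 0)"

text \<open>
  A maximal disjoint set of atoms works: a nonzero element disjoint from all of them would
  dominate an atom that could be added.
\<close>
lemma complete_atoms_exist:
  assumes fin: "\<And>S::'a::archimedean_vector_lattice set. disjoint_positive S \<Longrightarrow> finite S"
  shows "\<exists>A::'a set. complete_atoms A"
proof -
  define F where "F = {S::'a set. (\<forall>a\<in>S. atom a) \<and> pairwise (\<lambda>x y. inf x y = 0) S}"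
  have "\<exists>M\<in>F. \<forall>S\<in>F. M \<subseteq> S \<longrightarrow> S = M"
  proof (rule subset_Zorn')
    fix C assume C: "subset.chain F C"
    then have "chain\<^sub>\<subseteq> C" by (auto simp: subset.chain_def chain_subset_def)
    then have "pairwise (\<lambda>x y. inf x y = 0) (\<Union>C)"
      by (rule pairwise_chain_Union[rotated]) (use C in \<open>auto simp: subset.chain_def F_def\<close>)
    then show "\<Union>C \<in> F" using C by (auto simp: subset.chain_def F_def)
  qed
  then obtain A where A: "A \<in> F" "\<And>S. S \<in> F \<Longrightarrow> A \<subseteq> S \<Longrightarrow> S = A" by blast
  have atoms: "\<forall>a\<in>A. atom a" using A(1) by (simp add: F_def)
  have "finite A"
    by (rule fin) (use A(1) in \<open>auto simp: F_def disjoint_positive_def atom_def\<close>)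
  moreover have "x = 0" if x: "0 \<le> x" "\<forall>a\<in>A. inf x a = 0" for x
  proof (rule ccontr)
    assume "x \<noteq> 0"
    then obtain b where b: "b \<le> x" "atom b"
      using atom_below_of_finite_disjoint[OF fin] x(1) by (metis order_le_less)
    have "0 < b" using b(2) by (simp add: atom_def)
    have "inf b a = 0" if "a \<in> A" for a
    proof (rule disjoint_mono)
      show "inf x a = 0" using x(2) that by blast
      show "0 \<le> a" using atoms that by (auto simp: atom_def)
    qed (use \<open>0 < b\<close> b(1) in auto)
    then have "insert b A \<in> F"
      using A(1) b(2) by (auto simp: F_def pairwise_insert inf.commute)
    then have "b \<in> A" using A(2)[of "insert b A"] by blast
    then show False
      using \<open>\<And>a. a \<in> A \<Longrightarrow> inf b a = 0\<close>[of b] \<open>0 < b\<close> by simp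
  qed
  ultimately show ?thesis using atoms unfolding complete_atoms_def by blast
qed

lemma complete_atoms_expansion:
  fixes x :: "'a::archimedean_vector_lattice"
  assumes A: "complete_atoms A" and "0 \<le> x"
  shows "\<exists>t. (\<forall>a\<in>A. 0 \<le> t a \<and> t a *\<^sub>R a \<le> x) \<and> x = (\<Sum>a\<in>A. t a *\<^sub>R a)"
proof -
  obtain t where t: "\<forall>a\<in>A. 0 \<le> t a \<and> t a *\<^sub>R a \<le> x" "(\<Sum>a\<in>A. t a *\<^sub>R a) \<le> x"
    "\<forall>a\<in>A. inf (x - (\<Sum>a\<in>A. t a *\<^sub>R a)) a = 0"
    using atoms_decomposition[of A x] assms unfolding complete_atoms_def by blast
  have "0 \<le> x - (\<Sum>a\<in>A. t a *\<^sub>R a)" using t(2) by simp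
  then have "x - (\<Sum>a\<in>A. t a *\<^sub>R a) = 0"
    using A t(3) unfolding complete_atoms_def by blast
  then show ?thesis using t(1) by auto
qed

text \<open>
  Left to right, a disjoint set is linearly independent. Right to left, a complete set of atoms
  spans the positive cone, and with it the whole space.
\<close>
lemma finite_dimensional_iff_finite_disjoint:
  "(\<exists>B. finite_dimensional_vector_space (scaleR :: real \<Rightarrow> 'a \<Rightarrow> 'a) B) \<longleftrightarrow>
     (\<forall>S::'a::archimedean_vector_lattice set. disjoint_positive S \<longrightarrow> finite S)"
proof
  assume "\<exists>B. finite_dimensional_vector_space (scaleR :: real \<Rightarrow> 'a \<Rightarrow> 'a) B"
  then obtain B where "finite_dimensional_vector_space (scaleR :: real \<Rightarrow> 'a \<Rightarrow> 'a) B" ..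
  then interpret finite_dimensional_vector_space "scaleR :: real \<Rightarrow> 'a \<Rightarrow> 'a" B .
  show "\<forall>S::'a set. disjoint_positive S \<longrightarrow> finite S"
    using disjoint_positive_independent finiteI_independent
    unfolding dependent_raw_def by blast
next
  assume "\<forall>S::'a set. disjoint_positive S \<longrightarrow> finite S"
  then obtain A :: "'a set" where A: "complete_atoms A"
    using complete_atoms_exist by blast
  have pos: "x \<in> span A" if "0 \<le> x" for x
  proof -
    obtain t where "x = (\<Sum>a\<in>A. t a *\<^sub>R a)"
      using complete_atoms_expansion[OF A \<open>0 \<le> x\<close>] by blast
    then show ?thesis by (auto intro: span_sum span_scale span_base)
  qed
  have "x \<in> span A" for x
  proof -
    have "x = sup x 0 - sup (- x) 0"
      using prts[of x] neg_sup_eq_inf[of "- x" 0] by (simp add: pprt_def nprt_def)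
    moreover have "sup x 0 - sup (- x) 0 \<in> span A"
      by (intro span_diff pos) simp_all
    ultimately show ?thesis by simp
  qed
  then have "span A = UNIV" by blast
  obtain B where B: "B \<subseteq> A" "independent B" "A \<subseteq> span B"
    using maximal_independent_subset[of A] by blast
  have "finite B" using B(1) A finite_subset unfolding complete_atoms_def by blast
  moreover have "span B = UNIV"
    using span_mono[OF B(3)] \<open>span A = UNIV\<close> by (simp only: span_span top.extremum_unique)
  ultimately have "finite_dimensional_vector_space (scaleR :: real \<Rightarrow> 'a \<Rightarrow> 'a) B"
    using B(2) unfolding dependent_raw_def span_raw_def
    by unfold_locales (auto simp: algebra_simps)
  then show "\<exists>B. finite_dimensional_vector_space (scaleR :: real \<Rightarrow> 'a \<Rightarrow> 'a) B" ..
qed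

section \<open>Convergence of nets in finite dimension\<close>

lemma isGlb_UNIV_iff:
  "isGlb UNIV S (l::'a::order) \<longleftrightarrow> (\<forall>s\<in>S. l \<le> s) \<and> (\<forall>z. (\<forall>s\<in>S. z \<le> s) \<longrightarrow> z \<le> l)"
  by (auto simp: isGlb_def greatestP_def isLb_def setge_def setle_def)

lemma isLub_UNIV_iff:
  "isLub UNIV S (l::'a::order) \<longleftrightarrow> (\<forall>s\<in>S. s \<le> l) \<and> (\<forall>z. (\<forall>s\<in>S. s \<le> z) \<longrightarrow> l \<le> z)"
  by (auto simp: isLub_def leastP_def isUb_def setge_def setle_def)

lemma directed_finite_eventually:
  assumes D: "directed_set D le" and "finite A"
    and ev: "\<And>a. a \<in> A \<Longrightarrow> \<exists>d\<in>D. \<forall>i\<in>D. le d i \<longrightarrow> P a i"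
  shows "\<exists>d\<in>D. \<forall>i\<in>D. le d i \<longrightarrow> (\<forall>a\<in>A. P a i)"
  using \<open>finite A\<close> ev
proof (induction A)
  case empty
  then show ?case using D by (auto simp: directed_set_def)
next
  case (insert b A)
  obtain d where d: "d \<in> D" "\<forall>i\<in>D. le d i \<longrightarrow> (\<forall>a\<in>A. P a i)"
    using insert.IH insert.prems by blast
  obtain d' where d': "d' \<in> D" "\<forall>i\<in>D. le d' i \<longrightarrow> P b i"
    using insert.prems by blast
  obtain c where c: "c \<in> D" "le d c" "le d' c"
    using D d(1) d'(1) unfolding directed_set_def by blast
  have "\<forall>i\<in>D. le c i \<longrightarrow> le d i \<and> le d' i"
    using D c d(1) d'(1) unfolding directed_set_def transp_on_def by blast
  then show ?case using c(1) d(2) d'(2) by blast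
qed

lemma directed_set_Times:
  assumes "directed_set D le"
  shows "directed_set (D \<times> D) (rel_prod le le)"
proof -
  have "\<exists>r\<in>D \<times> D. rel_prod le le p r \<and> rel_prod le le q r" if "p \<in> D \<times> D" "q \<in> D \<times> D" for p q
  proof -
    have "\<exists>r\<in>D. le (fst p) r \<and> le (fst q) r" "\<exists>s\<in>D. le (snd p) s \<and> le (snd q) s"
      using assms that unfolding directed_set_def by (simp_all add: mem_Times_iff)
    then obtain r s where "r \<in> D" "le (fst p) r" "le (fst q) r" "s \<in> D" "le (snd p) s" "le (snd q) s"
      by blast
    then show ?thesis by (intro bexI[of _ "(r, s)"]) (auto simp: rel_prod_sel)
  qed
  moreover have "transp_on (D \<times> D) (rel_prod le le)"
  proof (rule transp_onI)
    fix p q r assume "p \<in> D \<times> D" "q \<in> D \<times> D" "r \<in> D \<times> D" "rel_prod le le p q" "rel_prod le le q r"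
    moreover have "transp_on D le" using assms by (simp add: directed_set_def)
    ultimately show "rel_prod le le p r"
      unfolding rel_prod_sel mem_Times_iff by (meson transp_onD)
  qed
  moreover have "reflp_on (D \<times> D) (rel_prod le le)"
    using assms by (auto simp: directed_set_def reflp_on_def)
  moreover have "D \<times> D \<noteq> {}" using assms by (simp add: directed_set_def)
  ultimately show ?thesis unfolding directed_set_def by blast
qed

text \<open>
  Truncating the net at the strong unit \<open>e = \<Sum>A\<close> gives an \<open>o\<close>-null net. For an atom \<open>a\<close> and
  \<open>\<delta> > 0\<close>, some member of a dominating net decreasing to \<open>0\<close> does not lie above \<open>\<delta> *\<^sub>R a\<close>, hence
  eventually neither does the truncated net. If \<open>\<delta> \<le> 1\<close>, the truncation is harmless, because
  \<open>\<delta> *\<^sub>R a \<le> e\<close>; so eventually all the finitely many coordinates of \<open>\<bar>x i\<bar>\<close> are below \<open>\<delta>\<close>.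
\<close>
lemma uo_null_uniformly_null:
  fixes x :: "'i \<Rightarrow> 'a::archimedean_vector_lattice"
  assumes A: "complete_atoms A" and D: "directed_set D le" and null: "uo_conv D le x 0"
    and "0 < \<epsilon>"
  shows "\<exists>d\<in>D. \<forall>i\<in>D. le d i \<longrightarrow> \<bar>x i\<bar> \<le> \<epsilon> *\<^sub>R \<Sum>A"
proof -
  have fin: "finite A" and pos: "\<And>a. a \<in> A \<Longrightarrow> 0 < a"
    using A by (auto simp: complete_atoms_def atom_def)
  define e where "e = \<Sum>A"
  have "0 \<le> e" unfolding e_def using pos by (intro sum_nonneg) (simp add: less_imp_le)
  obtain G leG and y :: "'a \<Rightarrow> 'a" where y: "directed_set G leG" "decreases_to_zero G leG y"
    "\<forall>g\<in>G. \<exists>d\<in>D. \<forall>i\<in>D. le d i \<longrightarrow> \<bar>inf \<bar>x i - 0\<bar> e - 0\<bar> \<le> y g"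
    using null \<open>0 \<le> e\<close> unfolding uo_conv_def o_conv_def by blast
  have inf: "z \<le> 0" if "\<forall>g\<in>G. z \<le> y g" for z
    using y(2) that unfolding decreases_to_zero_def isGlb_UNIV_iff by blast
  define \<delta> where "\<delta> = min \<epsilon> 1"
  have \<delta>: "0 < \<delta>" "\<delta> \<le> 1" "\<delta> \<le> \<epsilon>" using \<open>0 < \<epsilon>\<close> by (auto simp: \<delta>_def)
  have "\<exists>d\<in>D. \<forall>i\<in>D. le d i \<longrightarrow> (\<forall>a\<in>A. \<not> \<delta> *\<^sub>R a \<le> \<bar>x i\<bar>)"
  proof (rule directed_finite_eventually[OF D fin])
    fix a assume "a \<in> A"
    have "0 < \<delta> *\<^sub>R a" using \<delta>(1) pos[OF \<open>a \<in> A\<close>]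
      by (simp add: order_less_le scaleR_nonneg_nonneg)
    then have "\<not> \<delta> *\<^sub>R a \<le> 0" by simp
    then obtain g where g: "g \<in> G" "\<not> \<delta> *\<^sub>R a \<le> y g" using inf by blast
    obtain d where d: "d \<in> D" "\<forall>i\<in>D. le d i \<longrightarrow> \<bar>inf \<bar>x i - 0\<bar> e - 0\<bar> \<le> y g"
      using y(3) g(1) by blast
    have "\<delta> *\<^sub>R a \<le> 1 *\<^sub>R a"
      using \<delta>(2) pos[OF \<open>a \<in> A\<close>] by (intro scaleR_right_mono) auto
    also have "1 *\<^sub>R a \<le> e"
    proof -
      have "0 \<le> \<Sum>(A - {a})" using pos by (intro sum_nonneg) (simp add: less_imp_le)
      then show ?thesis unfolding e_def sum.remove[OF fin \<open>a \<in> A\<close>] by simp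
    qed
    finally have ae: "\<delta> *\<^sub>R a \<le> e" .
    have "\<not> \<delta> *\<^sub>R a \<le> \<bar>x i\<bar>" if "i \<in> D" "le d i" for i
    proof
      assume "\<delta> *\<^sub>R a \<le> \<bar>x i\<bar>"
      then have "\<delta> *\<^sub>R a \<le> inf \<bar>x i - 0\<bar> e" using ae by simp
      also have "\<dots> \<le> \<bar>inf \<bar>x i - 0\<bar> e - 0\<bar>" using abs_ge_self[of "inf \<bar>x i - 0\<bar> e"] by simp
      also have "\<dots> \<le> y g" using d(2) that by blast
      finally show False using g(2) by simp
    qed
    then show "\<exists>d\<in>D. \<forall>i\<in>D. le d i \<longrightarrow> \<not> \<delta> *\<^sub>R a \<le> \<bar>x i\<bar>" using d(1) by blast
  qed
  then obtain d where d: "d \<in> D" "\<And>i a. i \<in> D \<Longrightarrow> le d i \<Longrightarrow> a \<in> A \<Longrightarrow> \<not> \<delta> *\<^sub>R a \<le> \<bar>x i\<bar>"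
    by blast
  have "\<bar>x i\<bar> \<le> \<epsilon> *\<^sub>R e" if i: "i \<in> D" "le d i" for i
  proof -
    obtain t where t: "\<forall>a\<in>A. 0 \<le> t a \<and> t a *\<^sub>R a \<le> \<bar>x i\<bar>" "\<bar>x i\<bar> = (\<Sum>a\<in>A. t a *\<^sub>R a)"
      using complete_atoms_expansion[OF A, of "\<bar>x i\<bar>"] by auto
    have "t a \<le> \<delta>" if "a \<in> A" for a
    proof (rule ccontr)
      assume "\<not> t a \<le> \<delta>"
      then have "\<delta> *\<^sub>R a \<le> t a *\<^sub>R a"
        using pos[OF that] by (intro scaleR_right_mono) auto
      then show False using t(1) that d(2)[OF i that] order_trans by blast
    qed
    then have "\<bar>x i\<bar> \<le> (\<Sum>a\<in>A. \<delta> *\<^sub>R a)"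
      unfolding t(2) using pos by (intro sum_mono scaleR_right_mono) (auto simp: less_imp_le)
    also have "\<dots> = \<delta> *\<^sub>R e" by (simp add: e_def scaleR_sum_right)
    also have "\<dots> \<le> \<epsilon> *\<^sub>R e" using \<delta>(3) \<open>0 \<le> e\<close> by (rule scaleR_right_mono)
    finally show ?thesis .
  qed
  then show ?thesis using d(1) unfolding e_def by blast
qed

lemma o_conv_if_uniform:
  fixes x :: "'i \<Rightarrow> 'b::archimedean_vector_lattice"
  assumes "0 \<le> e"
    and unif: "\<And>\<epsilon>. 0 < \<epsilon> \<Longrightarrow> \<exists>d\<in>D. \<forall>i\<in>D. le d i \<longrightarrow> \<bar>x i - l\<bar> \<le> \<epsilon> *\<^sub>R e"
  shows "o_conv D le x l"
proof (rule o_convI)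
  let ?R = "{0<..} :: real set"
  show "directed_set ?R (\<ge>)"
  proof -
    have "\<exists>c\<in>?R. a \<ge> c \<and> b \<ge> c" if "a \<in> ?R" "b \<in> ?R" for a b
      using that by (intro bexI[of _ "min a b"]) auto
    moreover have "1 \<in> ?R" by simp
    ultimately show ?thesis
      unfolding directed_set_def reflp_on_def transp_on_def by fastforce
  qed
  show "decreases_to_zero ?R (\<ge>) (\<lambda>\<epsilon>. \<epsilon> *\<^sub>R e)"
    unfolding decreases_to_zero_def isGlb_UNIV_iff monotone_on_def
    using \<open>0 \<le> e\<close> archimedean_le_zero[OF \<open>0 \<le> e\<close>]
    by (auto intro: scaleR_right_mono scaleR_nonneg_nonneg)
  show "\<forall>\<epsilon>\<in>?R. \<exists>d\<in>D. \<forall>i\<in>D. le d i \<longrightarrow> \<bar>x i - l\<bar> \<le> \<epsilon> *\<^sub>R e"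
    using unif by simp
qed

text \<open>
  If the net stays within \<open>\<epsilon> *\<^sub>R e\<close> of \<open>x d\<close> after \<open>d\<close>, then its limit should lie between
  \<open>x d - \<epsilon> *\<^sub>R e\<close> and \<open>x d + \<epsilon> *\<^sub>R e\<close>. All the lower estimates are below all the upper ones, so the
  supremum of the lower estimates meets every one of these requirements.
\<close>
lemma uniformly_Cauchy_o_convergent:
  fixes x :: "'i \<Rightarrow> 'b::archimedean_vector_lattice"
  assumes ded: "dedekind_complete TYPE('b)" and D: "directed_set D le" and "0 \<le> e"
    and cauchy: "\<And>\<epsilon>. 0 < \<epsilon> \<Longrightarrow> \<exists>d\<in>D. \<forall>i\<in>D. le d i \<longrightarrow> \<bar>x i - x d\<bar> \<le> \<epsilon> *\<^sub>R e"
  shows "\<exists>l. o_conv D le x l"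
proof -
  \<comment> \<open>the bound \<open>\<epsilon> \<le> 1\<close> keeps the set \<open>S\<close> of lower estimates order bounded from below\<close>
  define good where "good d \<epsilon> \<longleftrightarrow> \<epsilon> \<le> 1 \<and> d \<in> D \<and> (\<forall>i\<in>D. le d i \<longrightarrow> \<bar>x i - x d\<bar> \<le> \<epsilon> *\<^sub>R e)" for d \<epsilon>
  have ex: "\<exists>d. good d \<epsilon>" if "0 < \<epsilon>" "\<epsilon> \<le> 1" for \<epsilon>
    using cauchy[OF that(1)] that(2) by (auto simp: good_def)
  have below_above: "x d - \<epsilon> *\<^sub>R e \<le> x d' + \<epsilon>' *\<^sub>R e" if "good d \<epsilon>" "good d' \<epsilon>'" for d d' \<epsilon> \<epsilon>'
  proof -
    obtain c where "c \<in> D" "le d c" "le d' c"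
      using D \<open>good d \<epsilon>\<close> \<open>good d' \<epsilon>'\<close> unfolding directed_set_def good_def by blast
    then have "\<bar>x c - x d\<bar> \<le> \<epsilon> *\<^sub>R e" "\<bar>x c - x d'\<bar> \<le> \<epsilon>' *\<^sub>R e"
      using that by (auto simp: good_def)
    then have "x d - \<epsilon> *\<^sub>R e \<le> x c" "x c \<le> x d' + \<epsilon>' *\<^sub>R e"
      by (simp_all add: abs_le_iff algebra_simps)
    then show ?thesis by (rule order_trans)
  qed
  define S where "S = {x d - \<epsilon> *\<^sub>R e | d \<epsilon>. good d \<epsilon>}"
  obtain d1 where d1: "good d1 1" using ex[of 1] by auto
  obtain l where l: "isLub UNIV S l"
  proof -
    have "S \<noteq> {}" using d1 by (auto simp: S_def)
    \<comment> \<open>a lower estimate is at most \<open>2 *\<^sub>R e\<close> below its upper estimate, which is above \<open>x d1 - e\<close>\<close>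
    moreover have "S \<subseteq> {x d1 - 3 *\<^sub>R e .. x d1 + 1 *\<^sub>R e}"
    proof
      fix s assume "s \<in> S"
      then obtain d \<epsilon> where s: "s = x d - \<epsilon> *\<^sub>R e" "good d \<epsilon>" by (auto simp: S_def)
      have "\<epsilon> *\<^sub>R e \<le> 1 *\<^sub>R e"
        using s(2) \<open>0 \<le> e\<close> by (intro scaleR_right_mono) (auto simp: good_def)
      moreover have "x d1 - 1 *\<^sub>R e \<le> x d + \<epsilon> *\<^sub>R e" by (rule below_above[OF d1 s(2)])
      ultimately have "x d1 - 1 *\<^sub>R e - (1 *\<^sub>R e + 1 *\<^sub>R e) \<le> x d + \<epsilon> *\<^sub>R e - (\<epsilon> *\<^sub>R e + \<epsilon> *\<^sub>R e)"
        by (intro diff_mono add_mono)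
      also have "\<dots> = s" by (simp add: s(1))
      also have "x d1 - 1 *\<^sub>R e - (1 *\<^sub>R e + 1 *\<^sub>R e) = x d1 - 3 *\<^sub>R e"
        by (simp add: scaleR_left_distrib[of 1 2, simplified] scaleR_2 diff_diff_eq)
      finally show "s \<in> {x d1 - 3 *\<^sub>R e .. x d1 + 1 *\<^sub>R e}"
        using below_above[OF s(2) d1] s(1) by simp
    qed
    ultimately show ?thesis
      using ded that unfolding dedekind_complete_def by blast
  qed
  have close: "\<bar>x d - l\<bar> \<le> \<epsilon> *\<^sub>R e" if "good d \<epsilon>" for d \<epsilon>
  proof -
    have "x d - \<epsilon> *\<^sub>R e \<le> l" using l that unfolding isLub_UNIV_iff S_def by blast
    moreover have "l \<le> x d + \<epsilon> *\<^sub>R e"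
      using l below_above[OF _ that] unfolding isLub_UNIV_iff S_def by blast
    ultimately show ?thesis by (simp add: abs_le_iff algebra_simps)
  qed
  have "o_conv D le x l"
  proof (rule o_conv_if_uniform[OF \<open>0 \<le> e\<close>])
    fix \<epsilon> :: real assume "0 < \<epsilon>"
    define \<delta> where "\<delta> = min (\<epsilon> / 2) 1"
    have "0 < \<delta>" "\<delta> \<le> 1" "\<delta> + \<delta> \<le> \<epsilon>" using \<open>0 < \<epsilon>\<close> by (auto simp: \<delta>_def)
    then obtain d where d: "good d \<delta>" using ex by blast
    have "\<bar>x i - l\<bar> \<le> \<epsilon> *\<^sub>R e" if "i \<in> D" "le d i" for i
    proof -
      have "\<bar>x i - l\<bar> \<le> \<bar>x i - x d\<bar> + \<bar>x d - l\<bar>"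
        using abs_triangle_ineq[of "x i - x d" "x d - l"] by simp
      also have "\<dots> \<le> \<delta> *\<^sub>R e + \<delta> *\<^sub>R e"
        using d close[OF d] that by (intro add_mono) (auto simp: good_def)
      also have "\<dots> \<le> \<epsilon> *\<^sub>R e"
        using scaleR_right_mono[OF \<open>\<delta> + \<delta> \<le> \<epsilon>\<close> \<open>0 \<le> e\<close>] unfolding scaleR_left_distrib .
      finally show ?thesis .
    qed
    then show "\<exists>d\<in>D. \<forall>i\<in>D. le d i \<longrightarrow> \<bar>x i - l\<bar> \<le> \<epsilon> *\<^sub>R e"
      using d by (auto simp: good_def)
  qed
  then show ?thesis ..
qed

section \<open>Unbounded order convergence\<close>

lemma uo_conv_iff_diff_null:
  "uo_conv D le x l \<longleftrightarrow> uo_conv D le (\<lambda>i. x i - l) 0"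
  by (simp add: uo_conv_def)

lemma decreases_to_zero_double:
  fixes y :: "'g \<Rightarrow> 'b::archimedean_vector_lattice"
  assumes "decreases_to_zero G leG y"
  shows "decreases_to_zero G leG (\<lambda>g. y g + y g)"
proof -
  have y: "monotone_on G leG (\<ge>) y" "\<And>g. g \<in> G \<Longrightarrow> 0 \<le> y g"
    "\<And>z. (\<forall>g\<in>G. z \<le> y g) \<Longrightarrow> z \<le> 0"
    using assms unfolding decreases_to_zero_def isGlb_UNIV_iff by auto
  have "z \<le> 0" if "\<forall>g\<in>G. z \<le> y g + y g" for z
  proof -
    have "(1/2) *\<^sub>R z \<le> 0"
    proof (intro y(3) ballI)
      fix g assume "g \<in> G"
      then have "(1/2) *\<^sub>R z \<le> (1/2) *\<^sub>R (y g + y g)"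
        using that by (intro scaleR_left_mono) auto
      also have "\<dots> = y g" by (simp flip: scaleR_2)
      finally show "(1/2) *\<^sub>R z \<le> y g" .
    qed
    from scaleR_left_mono[OF this, of 2] show ?thesis by simp
  qed
  then show ?thesis
    using y(1,2) unfolding decreases_to_zero_def isGlb_UNIV_iff monotone_on_def
    by (auto intro: add_mono)
qed

text \<open>
  From \<open>\<bar>x i - x j\<bar> \<le> \<bar>x i\<bar> + \<bar>x j\<bar>\<close> and the subadditivity of truncation, twice a net that dominates
  the truncations of \<open>x\<close> dominates those of the double net.
\<close>
lemma uo_null_imp_uo_cauchy:
  fixes x :: "'i \<Rightarrow> 'b::archimedean_vector_lattice"
  assumes "uo_conv D le x 0"
  shows "uo_cauchy D le x"
  unfolding uo_cauchy_def uo_conv_def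
proof (intro allI impI)
  fix u :: 'b assume "0 \<le> u"
  obtain G leG and y :: "'b \<Rightarrow> 'b" where y: "directed_set G leG" "decreases_to_zero G leG y"
    "\<forall>g\<in>G. \<exists>d\<in>D. \<forall>i\<in>D. le d i \<longrightarrow> \<bar>inf \<bar>x i - 0\<bar> u - 0\<bar> \<le> y g"
    using assms \<open>0 \<le> u\<close> unfolding uo_conv_def o_conv_def by blast
  show "o_conv (D \<times> D) (rel_prod le le) (\<lambda>p. inf \<bar>(case p of (i, j) \<Rightarrow> x i - x j) - 0\<bar> u) 0"
  proof (rule o_convI[OF y(1) decreases_to_zero_double[OF y(2)]], rule ballI)
    fix g assume "g \<in> G"
    then obtain d where d: "d \<in> D" "\<forall>i\<in>D. le d i \<longrightarrow> \<bar>inf \<bar>x i - 0\<bar> u - 0\<bar> \<le> y g"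
      using y(3) by blast
    have "\<bar>inf \<bar>x i - x j - 0\<bar> u - 0\<bar> \<le> y g + y g"
      if "i \<in> D" "j \<in> D" "le d i" "le d j" for i j
    proof -
      have "inf \<bar>x i - x j\<bar> u \<le> inf u (\<bar>x i\<bar> + \<bar>x j\<bar>)"
        using abs_triangle_ineq4[of "x i" "x j"] by (simp add: le_infI1)
      also have "\<dots> \<le> inf u \<bar>x i\<bar> + inf u \<bar>x j\<bar>"
        using \<open>0 \<le> u\<close> by (intro inf_add_le) auto
      also have "\<dots> \<le> y g + y g"
      proof (rule add_mono)
        have "inf u \<bar>x k\<bar> \<le> y g" if "k \<in> D" "le d k" for k
          using d(2) that \<open>0 \<le> u\<close> by (simp add: inf.commute)
        then show "inf u \<bar>x i\<bar> \<le> y g" "inf u \<bar>x j\<bar> \<le> y g" using that by auto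
      qed
      finally show ?thesis using \<open>0 \<le> u\<close> by simp
    qed
    then show "\<exists>p\<in>D \<times> D. \<forall>q\<in>D \<times> D. rel_prod le le p q \<longrightarrow>
        \<bar>inf \<bar>(case q of (i, j) \<Rightarrow> x i - x j) - 0\<bar> u - 0\<bar> \<le> y g + y g"
      using d(1) by (intro bexI[of _ "(d, d)"]) auto
  qed
qed

lemma o_conv_imp_eventually_order_bounded:
  fixes x :: "'i \<Rightarrow> 'b::archimedean_vector_lattice"
  assumes "o_conv D le x l"
  shows "eventually_order_bounded D le x"
proof -
  obtain G leG and y :: "'b \<Rightarrow> 'b" where y: "directed_set G leG"
    "\<forall>g\<in>G. \<exists>d\<in>D. \<forall>i\<in>D. le d i \<longrightarrow> \<bar>x i - l\<bar> \<le> y g"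
    using assms unfolding o_conv_def by blast
  obtain g where "g \<in> G" using y(1) by (auto simp: directed_set_def)
  then obtain d where d: "d \<in> D" "\<forall>i\<in>D. le d i \<longrightarrow> \<bar>x i - l\<bar> \<le> y g"
    using y(2) by blast
  have "\<bar>x i\<bar> \<le> \<bar>y g\<bar> + \<bar>l\<bar>" if "i \<in> D" "le d i" for i
  proof -
    have "\<bar>x i\<bar> \<le> \<bar>x i - l\<bar> + \<bar>l\<bar>" using abs_triangle_ineq[of "x i - l" l] by simp
    also have "\<dots> \<le> \<bar>y g\<bar> + \<bar>l\<bar>"
      using d(2) that abs_ge_self[of "y g"] by (intro add_mono) (auto intro: order_trans)
    finally show ?thesis .
  qed
  then show ?thesis
    using d(1) unfolding eventually_order_bounded_def
    by (intro bexI[of _ d] exI[of _ "\<bar>y g\<bar> + \<bar>l\<bar>"]) auto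
qed

text \<open>
  Truncated at \<open>y\<close>, the net is dominated by the set \<open>G\<close> of all upper bounds of its tails. The
  work is to show that \<open>G\<close> has infimum \<open>0\<close>, although the tails need not have suprema. A positive
  lower bound \<open>w\<close> of \<open>G\<close> that is disjoint from almost all \<open>e n\<close> can be subtracted from any member
  of \<open>G\<close> without leaving \<open>G\<close>; starting from \<open>y\<close>, this shows \<open>j *\<^sub>R w \<le> y\<close> for all \<open>j\<close>, and \<open>w\<close>
  vanishes. For an arbitrary positive lower bound \<open>w\<close>, this applies first to each \<open>inf w (e n)\<close>,
  which is disjoint from the later members of the sequence, and then to \<open>w\<close> itself.

  The surjection \<open>g\<close> transports the index set of pairs to any infinite type.
\<close>
lemma disjoint_multiples_uo_null:
  fixes e :: "nat \<Rightarrow> 'a::archimedean_vector_lattice" and g :: "'i \<Rightarrow> nat \<times> nat"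
  assumes "surj g" and e: "\<And>n. 0 \<le> e n" "\<And>m n. m \<noteq> n \<Longrightarrow> inf (e m) (e n) = 0"
  shows "uo_conv UNIV (\<lambda>i j. fst (g i) \<le> fst (g j)) (\<lambda>i. real (snd (g i)) *\<^sub>R e (fst (g i))) 0"
  unfolding uo_conv_def
proof (intro allI impI)
  fix y :: 'a assume "0 \<le> y"
  define p where "p n m = inf (real m *\<^sub>R e n) y" for n m :: nat
  have p_nonneg: "0 \<le> p n m" for n m
    using \<open>0 \<le> y\<close> e(1) by (simp add: p_def scaleR_nonneg_nonneg)
  define G where "G = {u. \<exists>k. \<forall>n\<ge>k. \<forall>m. p n m \<le> u}"
  have "y \<in> G" by (auto simp: G_def p_def)
  have G_nonneg: "0 \<le> u" if "u \<in> G" for u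
    using that p_nonneg order_trans unfolding G_def by blast
  have null: "w = 0"
    if w: "0 \<le> w" "\<And>u. u \<in> G \<Longrightarrow> w \<le> u" and "\<And>n. n \<ge> k \<Longrightarrow> inf w (e n) = 0" for w k
  proof -
    \<comment> \<open>\<open>w\<close> and the truncated multiples far out are disjoint and below \<open>u\<close>, so their sum is below \<open>u\<close> too\<close>
    have step: "u - w \<in> G" if "u \<in> G" for u
    proof -
      obtain k' where k': "\<And>n m. n \<ge> k' \<Longrightarrow> p n m \<le> u" using \<open>u \<in> G\<close> by (auto simp: G_def)
      have "p n m \<le> u - w" if n: "n \<ge> max k k'" for n m
      proof -
        have "inf w (real m *\<^sub>R e n) = 0"
          using \<open>\<And>n. n \<ge> k \<Longrightarrow> inf w (e n) = 0\<close> n by (intro disjoint_scaleR) auto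
        then have "inf w (p n m) = 0"
          by (rule disjoint_mono) (use w(1) p_nonneg in \<open>auto simp: p_def\<close>)
        then have "w + p n m \<le> u"
          using w(2)[OF \<open>u \<in> G\<close>] k'[of n m] n by (intro disjoint_add_le) auto
        then show ?thesis by (simp add: le_diff_eq add.commute)
      qed
      then show ?thesis unfolding G_def by blast
    qed
    have iter: "y - real j *\<^sub>R w \<in> G" for j :: nat
    proof (induction j)
      case 0
      then show ?case using \<open>y \<in> G\<close> by simp
    next
      case (Suc j)
      then show ?case using step by (fastforce simp: scaleR_left_distrib algebra_simps)
    qed
    show ?thesis
      using archimedean[OF w(1) \<open>0 \<le> y\<close>] G_nonneg[OF iter] by simp
  qed
  have glb: "z \<le> 0" if z: "\<And>u. u \<in> G \<Longrightarrow> z \<le> u" for z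
  proof -
    define w where "w = sup z 0"
    have w: "0 \<le> w" "\<And>u. u \<in> G \<Longrightarrow> w \<le> u" using z G_nonneg by (auto simp: w_def)
    have "inf w (e n) = 0" for n
    proof (rule null[of _ "Suc n"])
      show "0 \<le> inf w (e n)" using w(1) e(1) by simp
      show "inf w (e n) \<le> u" if "u \<in> G" for u using w(2)[OF that] by (rule le_infI1)
      show "inf (inf w (e n)) (e k) = 0" if "Suc n \<le> k" for k
        by (rule disjoint_mono[OF e(2)[of n k]]) (use that w(1) e(1) in auto)
    qed
    then have "w = 0" using null[OF w] by blast
    then show ?thesis by (metis w_def sup.cobounded1)
  qed
  show "o_conv UNIV (\<lambda>i j. fst (g i) \<le> fst (g j))
      (\<lambda>i. inf \<bar>real (snd (g i)) *\<^sub>R e (fst (g i)) - 0\<bar> y) 0"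
  proof (rule o_convI)
    show "directed_set G (\<ge>)"
    proof -
      have "\<exists>w\<in>G. u \<ge> w \<and> v \<ge> w" if uv: "u \<in> G" "v \<in> G" for u v
      proof -
        obtain k k' where "\<And>n m. n \<ge> k \<Longrightarrow> p n m \<le> u" "\<And>n m. n \<ge> k' \<Longrightarrow> p n m \<le> v"
          using uv unfolding G_def by blast
        then have "\<forall>n\<ge>max k k'. \<forall>m. p n m \<le> inf u v" by simp
        then have "inf u v \<in> G" unfolding G_def by blast
        then show ?thesis by (intro bexI[of _ "inf u v"]) auto
      qed
      then show ?thesis
        using \<open>y \<in> G\<close> by (auto simp: directed_set_def reflp_on_def transp_on_def)
    qed
    show "decreases_to_zero G (\<ge>) (\<lambda>u. u)"
      using G_nonneg glb unfolding decreases_to_zero_def isGlb_UNIV_iff monotone_on_def by auto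
    show "\<forall>u\<in>G. \<exists>i0\<in>UNIV. \<forall>i\<in>UNIV. fst (g i0) \<le> fst (g i) \<longrightarrow>
        \<bar>inf \<bar>real (snd (g i)) *\<^sub>R e (fst (g i)) - 0\<bar> y - 0\<bar> \<le> u"
    proof
      fix u assume "u \<in> G"
      then obtain k where k: "\<And>n m. n \<ge> k \<Longrightarrow> p n m \<le> u" by (auto simp: G_def)
      obtain i0 where "g i0 = (k, 0)" using \<open>surj g\<close> by (metis surjD)
      moreover have "\<bar>inf \<bar>real (snd (g i)) *\<^sub>R e (fst (g i)) - 0\<bar> y - 0\<bar> = p (fst (g i)) (snd (g i))" for i
        using p_nonneg[of "fst (g i)" "snd (g i)"] e(1)
        by (simp add: p_def abs_of_nonneg scaleR_nonneg_nonneg)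
      ultimately show "\<exists>i0\<in>UNIV. \<forall>i\<in>UNIV. fst (g i0) \<le> fst (g i) \<longrightarrow>
        \<bar>inf \<bar>real (snd (g i)) *\<^sub>R e (fst (g i)) - 0\<bar> y - 0\<bar> \<le> u"
        using k by (intro bexI[of _ i0]) auto
    qed
  qed
qed

text \<open>
  Since the preorder compares first components only, a tail contains every multiple of the \<open>e n\<close>
  at which it starts.
\<close>
lemma disjoint_multiples_unbounded:
  fixes e :: "nat \<Rightarrow> 'b::archimedean_vector_lattice" and g :: "'i \<Rightarrow> nat \<times> nat"
  assumes e: "\<And>n. 0 < e n" and "surj g"
  shows "\<not> eventually_order_bounded UNIV (\<lambda>i j. fst (g i) \<le> fst (g j))
           (\<lambda>i. real (snd (g i)) *\<^sub>R e (fst (g i)))"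
proof
  assume "eventually_order_bounded UNIV (\<lambda>i j. fst (g i) \<le> fst (g j))
           (\<lambda>i. real (snd (g i)) *\<^sub>R e (fst (g i)))"
  then obtain i0 y where y: "0 \<le> y"
    "\<And>i. fst (g i0) \<le> fst (g i) \<Longrightarrow> \<bar>real (snd (g i)) *\<^sub>R e (fst (g i))\<bar> \<le> y"
    unfolding eventually_order_bounded_def by auto
  let ?n = "fst (g i0)"
  have "real m *\<^sub>R e ?n \<le> y" for m
  proof -
    obtain i where "g i = (?n, m)" using \<open>surj g\<close> by (metis surjD)
    then have "\<bar>real m *\<^sub>R e ?n\<bar> \<le> y" using y(2)[of i] by simp
    then show ?thesis using abs_ge_self order_trans by blast
  qed
  then have "e ?n = 0" using e[of ?n] y(1) by (intro archimedean[of _ y]) auto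
  then show False using e[of ?n] by simp
qed

section \<open>The equivalence\<close>

lemma uo_null_bounded_imp_finite_dimensional:
  fixes T :: "'a::archimedean_vector_lattice \<Rightarrow> 'b::archimedean_vector_lattice"
  assumes T: "linear T" "inj T" "mono T" and "infinite (UNIV :: 'i set)"
    and bounded: "\<And>(D :: 'i set) le (x :: 'i \<Rightarrow> 'a). directed_set D le \<Longrightarrow>
      uo_conv D le x 0 \<Longrightarrow> eventually_order_bounded D le (\<lambda>i. T (x i))"
  shows "\<exists>B. finite_dimensional_vector_space (scaleR :: real \<Rightarrow> 'a \<Rightarrow> 'a) B"
  unfolding finite_dimensional_iff_finite_disjoint
proof (intro allI impI, rule ccontr)
  fix S :: "'a set" assume S: "disjoint_positive S" and "infinite S"
  obtain e :: "nat \<Rightarrow> 'a" where e: "inj e" "range e \<subseteq> S"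
    using infinite_countable_subset[OF \<open>infinite S\<close>] by blast
  have e_pos: "0 < e n" for n using S e(2) by (auto simp: disjoint_positive_def)
  have e_disj: "inf (e m) (e n) = 0" if "m \<noteq> n" for m n
    using S e that unfolding disjoint_positive_def pairwise_def inj_def by blast
  obtain f :: "nat \<Rightarrow> 'i" where "inj f"
    using infinite_countable_subset[OF assms(4)] by blast
  then have "surj (prod_decode \<circ> inv f)"
    using surj_prod_decode inj_imp_surj_inv by (intro comp_surj) auto
  then obtain g :: "'i \<Rightarrow> nat \<times> nat" where g: "surj g" by blast
  let ?le = "\<lambda>i j. fst (g i) \<le> fst (g j)"
  have "directed_set UNIV ?le"
    unfolding directed_set_def reflp_on_def transp_on_def by (auto intro: nle_le order_trans) (metis nle_le)
  then have "eventually_order_bounded UNIV ?le (\<lambda>i. T (real (snd (g i)) *\<^sub>R e (fst (g i))))"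
    by (rule bounded) (use e_pos e_disj in \<open>intro disjoint_multiples_uo_null[OF g], auto simp: less_imp_le\<close>)
  then have "eventually_order_bounded UNIV ?le (\<lambda>i. real (snd (g i)) *\<^sub>R T (e (fst (g i))))"
    by (simp add: linear_scale[OF T(1)])
  moreover have "0 < T (e n)" for n
    using monoD[OF T(3), of 0 "e n"] e_pos[of n] injD[OF T(2), of 0 "e n"] linear_0[OF T(1)]
    by (auto simp: order_less_le)
  ultimately show False using disjoint_multiples_unbounded[of "\<lambda>n. T (e n)" g] g by blast
qed

text \<open>
  Everything is reduced to uniform estimates by multiples of the strong unit \<open>e\<close>, which a lattice
  homomorphism carries over to \<open>T e\<close>.
\<close>
lemma finite_dimensional_uo_convergence:
  fixes T :: "'a::archimedean_vector_lattice \<Rightarrow> 'b::archimedean_vector_lattice"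
    and x :: "'i \<Rightarrow> 'a"
  assumes fd: "\<exists>B. finite_dimensional_vector_space (scaleR :: real \<Rightarrow> 'a \<Rightarrow> 'a) B"
    and T: "linear T" "mono T" "\<And>z. T \<bar>z\<bar> = \<bar>T z\<bar>"
    and ded: "dedekind_complete TYPE('b)" and D: "directed_set D le"
  shows "uo_cauchy D le x \<Longrightarrow> \<exists>l. o_conv D le (\<lambda>i. T (x i)) l"
    and "uo_conv D le x 0 \<Longrightarrow> o_conv D le (\<lambda>i. T (x i)) 0"
    and "uo_conv D le x l \<Longrightarrow> eventually_order_bounded D le x"
proof -
  obtain A :: "'a set" where A: "complete_atoms A"
    using fd complete_atoms_exist unfolding finite_dimensional_iff_finite_disjoint by blast
  define e where "e = \<Sum>A"
  have "0 \<le> e"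
    unfolding e_def using A by (intro sum_nonneg) (auto simp: complete_atoms_def atom_def less_imp_le)
  then have Te: "0 \<le> T e" using monoD[OF T(2), of 0 e] linear_0[OF T(1)] by simp
  have T_le: "\<bar>T z\<bar> \<le> \<epsilon> *\<^sub>R T e" if "\<bar>z\<bar> \<le> \<epsilon> *\<^sub>R e" for z \<epsilon>
    using monoD[OF T(2) that] by (simp add: T(3) linear_scale[OF T(1)])
  show "\<exists>l. o_conv D le (\<lambda>i. T (x i)) l" if "uo_cauchy D le x"
  proof (rule uniformly_Cauchy_o_convergent[OF ded D Te])
    fix \<epsilon> :: real assume "0 < \<epsilon>"
    obtain p where p: "p \<in> D \<times> D"
      "\<forall>q\<in>D \<times> D. rel_prod le le p q \<longrightarrow> \<bar>case q of (i, j) \<Rightarrow> x i - x j\<bar> \<le> \<epsilon> *\<^sub>R e"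
      using uo_null_uniformly_null[OF A directed_set_Times[OF D] \<open>uo_cauchy D le x\<close>[unfolded uo_cauchy_def] \<open>0 < \<epsilon>\<close>]
      unfolding e_def by blast
    obtain d where d: "d \<in> D" "le (fst p) d" "le (snd p) d"
      using D p(1) unfolding directed_set_def by (auto simp: mem_Times_iff)
    have "\<bar>T (x i) - T (x d)\<bar> \<le> \<epsilon> *\<^sub>R T e" if i: "i \<in> D" "le d i" for i
    proof -
      have "transp_on D le" using D by (simp add: directed_set_def)
      then have "le (fst p) i"
        using transp_onD[of D le "fst p" d i] p(1) d i by (simp add: mem_Times_iff)
      then have "\<bar>x i - x d\<bar> \<le> \<epsilon> *\<^sub>R e"
        using p(2)[rule_format, of "(i, d)"] i(1) d by (simp add: rel_prod_sel)
      from T_le[OF this] show ?thesis by (simp add: linear_diff[OF T(1)])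
    qed
    then show "\<exists>d\<in>D. \<forall>i\<in>D. le d i \<longrightarrow> \<bar>T (x i) - T (x d)\<bar> \<le> \<epsilon> *\<^sub>R T e" using d(1) by blast
  qed
  show "o_conv D le (\<lambda>i. T (x i)) 0" if "uo_conv D le x 0"
  proof (rule o_conv_if_uniform[OF Te])
    fix \<epsilon> :: real assume "0 < \<epsilon>"
    show "\<exists>d\<in>D. \<forall>i\<in>D. le d i \<longrightarrow> \<bar>T (x i) - 0\<bar> \<le> \<epsilon> *\<^sub>R T e"
      using uo_null_uniformly_null[OF A D that \<open>0 < \<epsilon>\<close>] T_le unfolding e_def[symmetric] diff_zero
      by blast
  qed
  show "eventually_order_bounded D le x" if "uo_conv D le x l"
  proof (rule o_conv_imp_eventually_order_bounded, rule o_conv_if_uniform[OF \<open>0 \<le> e\<close>])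
    show "\<exists>d\<in>D. \<forall>i\<in>D. le d i \<longrightarrow> \<bar>x i - l\<bar> \<le> \<epsilon> *\<^sub>R e" if "0 < \<epsilon>" for \<epsilon> :: real
      using uo_null_uniformly_null[OF A D _ that] \<open>uo_conv D le x l\<close>
      unfolding e_def uo_conv_iff_diff_null[of D le x l] by blast
  qed
qed

lemma eventually_order_bounded_image:
  assumes "mono T" "\<And>z. T \<bar>z\<bar> = \<bar>T z\<bar>" "eventually_order_bounded D le x"
  shows "eventually_order_bounded D le (\<lambda>i. T (x i))"
proof -
  obtain d y where dy: "d \<in> D" "\<forall>i\<in>D. le d i \<longrightarrow> \<bar>x i\<bar> \<le> y"
    using assms(3) unfolding eventually_order_bounded_def by blast
  have "\<bar>T (x i)\<bar> \<le> \<bar>T y\<bar>" if "i \<in> D" "le d i" for i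
    using monoD[OF assms(1), of "\<bar>x i\<bar>" y] dy(2) that assms(2) abs_ge_self[of "T y"]
    by (metis order_trans)
  then show ?thesis
    using dy(1) unfolding eventually_order_bounded_def
    by (intro bexI[of _ d] exI[of _ "\<bar>T y\<bar>"]) auto
qed

theorem theorem1:
  fixes T :: "'a::archimedean_vector_lattice \<Rightarrow> 'b::archimedean_vector_lattice"
  assumes "universal_completion T"
    and "infinite (UNIV :: 'i set)"
  shows
    "let C1 = (\<exists>B. finite_dimensional_vector_space (scaleR :: real \<Rightarrow> 'a \<Rightarrow> 'a) B);
         C2 = (\<forall>(D :: 'i set) le (x :: 'i \<Rightarrow> 'a). directed_set D le \<longrightarrow> 
          uo_cauchy D le x \<longrightarrow> eventually_order_bounded D le (\<lambda>a. T (x a)));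
         C3 = (\<forall>(D :: 'i set) le (x :: 'i \<Rightarrow> 'a). directed_set D le \<longrightarrow> 
          uo_cauchy D le x \<longrightarrow> (\<exists>l. o_conv D le (\<lambda>a. T (x a)) l));
         C4 = (\<forall>(D :: 'i set) le (x :: 'i \<Rightarrow> 'a). directed_set D le \<longrightarrow> 
          uo_conv D le x 0 \<longrightarrow> o_conv D le (\<lambda>a. T (x a)) 0);
         C5 = (\<forall>(D :: 'i set) le (x :: 'i \<Rightarrow> 'a). directed_set D le \<longrightarrow> 
          uo_conv D le x 0 \<longrightarrow> eventually_order_bounded D le (\<lambda>a. T (x a)));
         C6 = (\<forall>(D :: 'i set) le (x :: 'i \<Rightarrow> 'a). directed_set D le \<longrightarrow> 
          (\<exists>l. uo_conv D le x l) \<longrightarrow> eventually_order_bounded D le (\<lambda>a. T (x a)));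
         C7 = (\<forall>(D :: 'i set) le (x :: 'i \<Rightarrow> 'a). directed_set D le \<longrightarrow> 
          (\<exists>l. uo_conv D le x l) \<longrightarrow> eventually_order_bounded D le x)
     in (C1 \<longleftrightarrow> C2) \<and> (C1 \<longleftrightarrow> C3) \<and> (C1 \<longleftrightarrow> C4) \<and>
        (C1 \<longleftrightarrow> C5) \<and> (C1 \<longleftrightarrow> C6) \<and> (C1 \<longleftrightarrow> C7)"
proof -
  have uc: "universally_complete TYPE('b)" and lin: "linear T" and "inj T"
    and sup: "\<And>x y. T (sup x y) = sup (T x) (T y)"
    using assms(1) unfolding universal_completion_def by auto
  have ded: "dedekind_complete TYPE('b)" using uc by (simp add: universally_complete_def)
  have "mono T"
  proof (rule monoI)
    fix x y :: 'a assume "x \<le> y"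
    then show "T x \<le> T y" by (metis sup le_iff_sup)
  qed
  have abs: "T \<bar>z\<bar> = \<bar>T z\<bar>" for z
    by (simp add: abs_lattice sup linear_neg[OF lin])
  note unbounded_net = uo_null_bounded_imp_finite_dimensional[OF lin \<open>inj T\<close> \<open>mono T\<close> assms(2)]
  note fd = finite_dimensional_uo_convergence[OF _ lin \<open>mono T\<close> abs ded]
  note bdd = o_conv_imp_eventually_order_bounded
  note image = eventually_order_bounded_image[OF \<open>mono T\<close> abs]
  show ?thesis
    unfolding Let_def
  proof (intro conjI iffI allI impI, goal_cases)
    case (1 D le x)
    then show ?case using fd(1) bdd by blast
  next
    case 2
    then show ?case using unbounded_net uo_null_imp_uo_cauchy by blast
  next
    case (3 D le x)
    then show ?case using fd(1) by blast
  next
    case 4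
    then show ?case using unbounded_net uo_null_imp_uo_cauchy bdd by blast
  next
    case (5 D le x)
    then show ?case using fd(2) by blast
  next
    case 6
    then show ?case using unbounded_net bdd by blast
  next
    case (7 D le x)
    then show ?case using fd(2) bdd by blast
  next
    case 8
    then show ?case using unbounded_net by blast
  next
    case (9 D le x)
    then show ?case using fd(3) image by blast
  next
    case 10
    then show ?case using unbounded_net by blast
  next
    case (11 D le x)
    then show ?case using fd(3) by blast
  next
    case 12
    then show ?case using unbounded_net image by blast
  qed
qed

end
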